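(* Let $\mathfrak{q}$ be a Leibniz algebra over $\mathbb{K}$. Then $Z^{*}_{\mathrm{Lie}}(\mathfrak{q})=0$ if and only if $\mathfrak{q}$ is a $\mathrm{Lie}$-capable Leibniz algebra.
   Context: $\mathbb{K}$ is a field with $\frac12\in\mathbb{K}$. A Leibniz algebra is a $\mathbb{K}$-vector space with a bilinear bracket satisfying $[x,[y,z]]=[[x,y],z]-[[x,z],y]$. The $\mathrm{Lie}$-center of $\mathfrak{g}$ is $Z_{\mathrm{Lie}}(\mathfrak{g})=\{z\in\mathfrak{g}\mid[x,z]+[z,x]=0\text{ for all }x\in\mathfrak{g}\}$ (a two-sided ideal). A $\mathrm{Lie}$-central extension is a surjective homomorphism $f:\mathfrak{g}\twoheadrightarrow\mathfrak{q}$ of Leibniz algebras with $\ker f\subseteq Z_{\mathrm{Lie}}(\mathfrak{g})$. $\mathfrak{q}$ is $\mathrm{Lie}$-capable if there exists a $\mathrm{Lie}$-central extension $0\to Z_{\mathrm{Lie}}(\mathfrak{g})\to\mathfrak{g}\stackrel{f}{\to}\mathfrak{q}\to0$, i.e. one with $\ker f=Z_{\mathrm{Lie}}(\mathfrak{g})$. The precise $\mathrm{Lie}$-center $Z^{*}_{\mathrm{Lie}}(\mathfrak{q})$ is the intersection of all two-sided ideals $f(Z_{\mathrm{Lie}}(\mathfrak{g}))$ of $\mathfrak{q}$, where $f:\mathfrak{g}\twoheadrightarrow\mathfrak{q}$ ranges over all $\mathrm{Lie}$-central extensions of $\mathfrak{q}$. *)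

theory Defs
  imports "HOL-Algebra.Module" "HOL-Algebra.AbelCoset"
begin

text \<open>
  A Leibniz algebra is carried by a library \<open>module\<close> record; as for the library's \<open>algebra\<close>
  locale, the product \<open>\<otimes>\<close> of the record is the product of the algebra, that is, the Leibniz
  bracket \<open>[x, y]\<close>. The field \<open>one\<close> of the record carries no information.
\<close>

locale leibniz_algebra = K?: field K + module K L for K (structure) and L (structure) +
  assumes bracket_closed:
      "\<lbrakk>x \<in> carrier L; y \<in> carrier L\<rbrakk> \<Longrightarrow> x \<otimes>\<^bsub>L\<^esub> y \<in> carrier L"
    and bracket_add_left:
      "\<lbrakk>x \<in> carrier L; y \<in> carrier L; z \<in> carrier L\<rbrakk>
        \<Longrightarrow> (x \<oplus>\<^bsub>L\<^esub> y) \<otimes>\<^bsub>L\<^esub> z = x \<otimes>\<^bsub>L\<^esub> z \<oplus>\<^bsub>L\<^esub> y \<otimes>\<^bsub>L\<^esub> z"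
    and bracket_add_right:
      "\<lbrakk>x \<in> carrier L; y \<in> carrier L; z \<in> carrier L\<rbrakk>
        \<Longrightarrow> x \<otimes>\<^bsub>L\<^esub> (y \<oplus>\<^bsub>L\<^esub> z) = x \<otimes>\<^bsub>L\<^esub> y \<oplus>\<^bsub>L\<^esub> x \<otimes>\<^bsub>L\<^esub> z"
    and bracket_smult_left:
      "\<lbrakk>a \<in> carrier K; x \<in> carrier L; y \<in> carrier L\<rbrakk>
        \<Longrightarrow> (a \<odot>\<^bsub>L\<^esub> x) \<otimes>\<^bsub>L\<^esub> y = a \<odot>\<^bsub>L\<^esub> (x \<otimes>\<^bsub>L\<^esub> y)"
    and bracket_smult_right:
      "\<lbrakk>a \<in> carrier K; x \<in> carrier L; y \<in> carrier L\<rbrakk>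
        \<Longrightarrow> x \<otimes>\<^bsub>L\<^esub> (a \<odot>\<^bsub>L\<^esub> y) = a \<odot>\<^bsub>L\<^esub> (x \<otimes>\<^bsub>L\<^esub> y)"
    and leibniz_identity:
      "\<lbrakk>x \<in> carrier L; y \<in> carrier L; z \<in> carrier L\<rbrakk>
        \<Longrightarrow> x \<otimes>\<^bsub>L\<^esub> (y \<otimes>\<^bsub>L\<^esub> z) = ((x \<otimes>\<^bsub>L\<^esub> y) \<otimes>\<^bsub>L\<^esub> z) \<ominus>\<^bsub>L\<^esub> ((x \<otimes>\<^bsub>L\<^esub> z) \<otimes>\<^bsub>L\<^esub> y)"

definition Lie_center :: "('k, 'a, 'n) module_scheme \<Rightarrow> 'a set" where
  "Lie_center G =
    {z \<in> carrier G. \<forall>x\<in>carrier G. x \<otimes>\<^bsub>G\<^esub> z \<oplus>\<^bsub>G\<^esub> z \<otimes>\<^bsub>G\<^esub> x = \<zero>\<^bsub>G\<^esub>}"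

definition leibniz_hom ::
  "('k, 'm) ring_scheme \<Rightarrow> ('k, 'a, 'n) module_scheme \<Rightarrow> ('k, 'b, 'p) module_scheme \<Rightarrow> ('a \<Rightarrow> 'b) set"
where
  "leibniz_hom K G H =
    {f \<in> carrier G \<rightarrow> carrier H.
      (\<forall>x\<in>carrier G. \<forall>y\<in>carrier G. f (x \<oplus>\<^bsub>G\<^esub> y) = f x \<oplus>\<^bsub>H\<^esub> f y) \<and>
      (\<forall>a\<in>carrier K. \<forall>x\<in>carrier G. f (a \<odot>\<^bsub>G\<^esub> x) = a \<odot>\<^bsub>H\<^esub> f x) \<and>
      (\<forall>x\<in>carrier G. \<forall>y\<in>carrier G. f (x \<otimes>\<^bsub>G\<^esub> y) = f x \<otimes>\<^bsub>H\<^esub> f y)}"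

definition Lie_central_extension ::
  "('k, 'm) ring_scheme \<Rightarrow> ('k, 'g, 'n) module_scheme \<Rightarrow> ('g \<Rightarrow> 'a) \<Rightarrow> ('k, 'a, 'p) module_scheme \<Rightarrow> bool"
where
  "Lie_central_extension K G f Q \<longleftrightarrow>
    leibniz_algebra K G \<and> leibniz_algebra K Q \<and> f \<in> leibniz_hom K G Q \<and>
    f ` carrier G = carrier Q \<and> a_kernel G Q f \<subseteq> Lie_center G"

text \<open>
  The next two notions quantify over all Lie-central extensions of \<open>Q\<close>. HOL cannot quantify over
  the type carrying the extension, so these range over the algebras \<open>G\<close> carried by subsets of the
  type \<open>'a list\<close>, where \<open>'a\<close> is the type carrying \<open>Q\<close>. Nothing is lost: the theorems
  \<open>precise_Lie_center_subset\<close> and \<open>Lie_capableI\<close> below show that extensions carried by any other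
  type, however large, change neither notion. The reason is that an extension may be replaced by
  the subalgebra generated by preimages of the elements of \<open>Q\<close>.
\<close>

definition precise_Lie_center ::
  "('k, 'm) ring_scheme \<Rightarrow> ('k, 'a, 'n) module_scheme \<Rightarrow> 'a set" where
  "precise_Lie_center K Q =
    \<Inter> {f ` Lie_center G | (G :: ('k, 'a list) module) f. Lie_central_extension K G f Q}"

definition Lie_capable :: "('k, 'm) ring_scheme \<Rightarrow> ('k, 'a, 'n) module_scheme \<Rightarrow> bool" where
  "Lie_capable K Q \<longleftrightarrow>
    (\<exists>(G :: ('k, 'a list) module) f. Lie_central_extension K G f Q \<and> a_kernel G Q f = Lie_center G)"


subsection \<open>Independence of the type carrying the extensions\<close>

definition transport :: "('g \<Rightarrow> 'u) \<Rightarrow> 'g set \<Rightarrow> ('k, 'g, 'n) module_scheme \<Rightarrow> ('k, 'u) module" where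
  "transport e H G = (let d = inv_into H e in
    \<lparr>carrier = e ` H, mult = (\<lambda>u v. e (d u \<otimes>\<^bsub>G\<^esub> d v)), one = e \<one>\<^bsub>G\<^esub>, zero = e \<zero>\<^bsub>G\<^esub>,
     add = (\<lambda>u v. e (d u \<oplus>\<^bsub>G\<^esub> d v)), smult = (\<lambda>a u. e (a \<odot>\<^bsub>G\<^esub> d u))\<rparr>)"

locale leibniz_subalgebra = leibniz_algebra K G for K (structure) and G (structure) +
  fixes H
  assumes subset: "H \<subseteq> carrier G"
    and zero_mem: "\<zero>\<^bsub>G\<^esub> \<in> H"
    and add_mem: "\<lbrakk>x \<in> H; y \<in> H\<rbrakk> \<Longrightarrow> x \<oplus>\<^bsub>G\<^esub> y \<in> H"
    and smult_mem: "\<lbrakk>a \<in> carrier K; x \<in> H\<rbrakk> \<Longrightarrow> a \<odot>\<^bsub>G\<^esub> x \<in> H"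
    and bracket_mem: "\<lbrakk>x \<in> H; y \<in> H\<rbrakk> \<Longrightarrow> x \<otimes>\<^bsub>G\<^esub> y \<in> H"
begin

lemma mem_carrier: "x \<in> H \<Longrightarrow> x \<in> carrier G"
  using subset by blast

lemma uminus_mem: assumes "x \<in> H" shows "\<ominus>\<^bsub>G\<^esub> x \<in> H"
proof -
  have "(\<ominus>\<^bsub>K\<^esub> \<one>\<^bsub>K\<^esub>) \<odot>\<^bsub>G\<^esub> x = \<ominus>\<^bsub>G\<^esub> x"
    using mem_carrier[OF assms] by (simp add: smult_l_minus)
  then show ?thesis
    using smult_mem[OF _ assms, of "\<ominus>\<^bsub>K\<^esub> \<one>\<^bsub>K\<^esub>"] by simp
qed

context
  fixes e :: "'c \<Rightarrow> 'u"
  assumes inj: "inj_on e H"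
begin

abbreviation "T \<equiv> transport e H G"

lemma inv_e [simp]: "x \<in> H \<Longrightarrow> inv_into H e (e x) = x"
  using inj by simp

lemma transport_simps:
  "carrier T = e ` H" "\<zero>\<^bsub>T\<^esub> = e \<zero>\<^bsub>G\<^esub>"
  "\<lbrakk>x \<in> H; y \<in> H\<rbrakk> \<Longrightarrow> e x \<oplus>\<^bsub>T\<^esub> e y = e (x \<oplus>\<^bsub>G\<^esub> y)"
  "\<lbrakk>x \<in> H; y \<in> H\<rbrakk> \<Longrightarrow> e x \<otimes>\<^bsub>T\<^esub> e y = e (x \<otimes>\<^bsub>G\<^esub> y)"
  "x \<in> H \<Longrightarrow> a \<odot>\<^bsub>T\<^esub> e x = e (a \<odot>\<^bsub>G\<^esub> x)"
  by (simp_all add: transport_def Let_def)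

lemma transport_abelian_group: "abelian_group T"
proof (rule abelian_groupI)
  fix u assume "u \<in> carrier T"
  then obtain x where x: "x \<in> H" "u = e x" by (auto simp: transport_simps)
  show "\<exists>y\<in>carrier T. y \<oplus>\<^bsub>T\<^esub> u = \<zero>\<^bsub>T\<^esub>"
    using x uminus_mem[OF x(1)] mem_carrier[OF x(1)]
    by (intro bexI[of _ "e (\<ominus>\<^bsub>G\<^esub> x)"]) (auto simp: transport_simps M.l_neg)
qed (auto simp: transport_simps add_mem zero_mem mem_carrier M.a_ac)

lemma transport_minus:
  assumes "x \<in> H" "y \<in> H"
  shows "e x \<ominus>\<^bsub>T\<^esub> e y = e (x \<ominus>\<^bsub>G\<^esub> y)"
proof -
  interpret T: abelian_group T by (rule transport_abelian_group)
  have "e (\<ominus>\<^bsub>G\<^esub> y) \<oplus>\<^bsub>T\<^esub> e y = \<zero>\<^bsub>T\<^esub>"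
    using assms uminus_mem[OF assms(2)] mem_carrier by (simp add: transport_simps M.l_neg)
  then have "\<ominus>\<^bsub>T\<^esub> (e y) = e (\<ominus>\<^bsub>G\<^esub> y)"
    using assms uminus_mem[OF assms(2)] by (intro T.minus_equality) (auto simp: transport_simps)
  then show ?thesis
    using assms uminus_mem by (simp add: a_minus_def transport_simps)
qed

lemma transport_leibniz_algebra: "leibniz_algebra K T"
proof -
  have m: "module K T"
    by (rule moduleI[OF K.is_cring transport_abelian_group])
      (auto simp: transport_simps smult_mem add_mem mem_carrier smult_l_distr smult_r_distr smult_assoc1)
  have f: "field K" by unfold_locales
  have minus_mem: "x \<in> H \<Longrightarrow> y \<in> H \<Longrightarrow> x \<ominus>\<^bsub>G\<^esub> y \<in> H" for x y
    by (simp add: a_minus_def add_mem uminus_mem)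
  show ?thesis
    by (rule leibniz_algebra.intro[OF f m], unfold_locales)
      (auto simp: transport_simps transport_minus bracket_mem smult_mem add_mem mem_carrier
        bracket_add_left bracket_add_right bracket_smult_left bracket_smult_right leibniz_identity)
qed

text \<open>If a subalgebra maps onto \<open>Q\<close>, it already computes the image of the Lie-center.\<close>

lemma transport_extension:
  assumes ext: "Lie_central_extension K G f Q" and onto: "f ` H = carrier Q"
  defines "f' \<equiv> f \<circ> inv_into H e"
  shows "Lie_central_extension K T f' Q"
    and "f' ` Lie_center T = f ` Lie_center G"
    and "a_kernel G Q f = Lie_center G \<Longrightarrow> a_kernel T Q f' = Lie_center T"
proof -
  have ker: "a_kernel G Q f \<subseteq> Lie_center G" and Q: "leibniz_algebra K Q"
    and hom: "f \<in> leibniz_hom K G Q"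
    using ext by (auto simp: Lie_central_extension_def)
  interpret Q: leibniz_algebra K Q by (rule Q)
  have f_add: "f (x \<oplus>\<^bsub>G\<^esub> y) = f x \<oplus>\<^bsub>Q\<^esub> f y" if "x \<in> carrier G" "y \<in> carrier G" for x y
    using hom that by (auto simp: leibniz_hom_def)
  have f_smult: "f (a \<odot>\<^bsub>G\<^esub> x) = a \<odot>\<^bsub>Q\<^esub> f x" if "a \<in> carrier K" "x \<in> carrier G" for a x
    using hom that by (auto simp: leibniz_hom_def)
  have f_bracket: "f (x \<otimes>\<^bsub>G\<^esub> y) = f x \<otimes>\<^bsub>Q\<^esub> f y" if "x \<in> carrier G" "y \<in> carrier G" for x y
    using hom that by (auto simp: leibniz_hom_def)
  have f_closed: "f x \<in> carrier Q" if "x \<in> carrier G" for x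
    using hom that by (auto simp: leibniz_hom_def)
  have split: "\<exists>h\<in>H. \<exists>k\<in>Lie_center G. x = h \<oplus>\<^bsub>G\<^esub> k \<and> f h = f x" if x: "x \<in> carrier G" for x
  proof -
    obtain h where h: "h \<in> H" "f h = f x"
      using onto f_closed[OF x] by (metis imageE)
    define k where "k = \<ominus>\<^bsub>G\<^esub> h \<oplus>\<^bsub>G\<^esub> x"
    have hG: "h \<in> carrier G" using h mem_carrier by blast
    then have kG: "k \<in> carrier G" using x by (simp add: k_def)
    have xk: "x = h \<oplus>\<^bsub>G\<^esub> k" using hG x by (simp add: k_def M.r_neg2)
    then have "f h \<oplus>\<^bsub>Q\<^esub> f k = f h" using h f_add[OF hG kG] by simp
    then have "f k = \<zero>\<^bsub>Q\<^esub>"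
      using f_closed[OF hG] f_closed[OF kG] by simp
    then have "k \<in> Lie_center G" using ker kG by (auto simp: a_kernel_def')
    then show ?thesis using h xk by blast
  qed
  have Z_carrier: "z \<in> carrier G" if "z \<in> Lie_center G" for z
    using that by (auto simp: Lie_center_def)
  have Z_zero: "x \<otimes>\<^bsub>G\<^esub> z \<oplus>\<^bsub>G\<^esub> z \<otimes>\<^bsub>G\<^esub> x = \<zero>\<^bsub>G\<^esub>"
    if "z \<in> Lie_center G" "x \<in> carrier G" for z x
    using that by (auto simp: Lie_center_def)
  have Z_H: "z \<in> Lie_center G"
    if z: "z \<in> H" and zz: "\<forall>x\<in>H. x \<otimes>\<^bsub>G\<^esub> z \<oplus>\<^bsub>G\<^esub> z \<otimes>\<^bsub>G\<^esub> x = \<zero>\<^bsub>G\<^esub>" for z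
  proof -
    have zG: "z \<in> carrier G" using z mem_carrier by blast
    have "x \<otimes>\<^bsub>G\<^esub> z \<oplus>\<^bsub>G\<^esub> z \<otimes>\<^bsub>G\<^esub> x = \<zero>\<^bsub>G\<^esub>" if x: "x \<in> carrier G" for x
    proof -
      obtain h k where hk: "h \<in> H" "k \<in> Lie_center G" "x = h \<oplus>\<^bsub>G\<^esub> k"
        using split[OF x] by blast
      have c: "h \<in> carrier G" "k \<in> carrier G" using hk mem_carrier Z_carrier by auto
      have "x \<otimes>\<^bsub>G\<^esub> z \<oplus>\<^bsub>G\<^esub> z \<otimes>\<^bsub>G\<^esub> x =
          (h \<otimes>\<^bsub>G\<^esub> z \<oplus>\<^bsub>G\<^esub> z \<otimes>\<^bsub>G\<^esub> h) \<oplus>\<^bsub>G\<^esub> (z \<otimes>\<^bsub>G\<^esub> k \<oplus>\<^bsub>G\<^esub> k \<otimes>\<^bsub>G\<^esub> z)"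
        using c zG unfolding hk(3)
        by (simp add: bracket_add_left bracket_add_right bracket_closed M.a_ac)
      also have "\<dots> = \<zero>\<^bsub>G\<^esub>" using zz hk Z_zero[OF hk(2) zG] by simp
      finally show ?thesis .
    qed
    then show ?thesis using zG by (simp add: Lie_center_def)
  qed
  have eq0: "e x = e \<zero>\<^bsub>G\<^esub> \<longleftrightarrow> x = \<zero>\<^bsub>G\<^esub>" if "x \<in> H" for x
    using inj that zero_mem by (meson inj_on_eq_iff)
  have ZT: "Lie_center T = e ` (Lie_center G \<inter> H)"
  proof (rule equalityI; rule subsetI)
    fix u assume u: "u \<in> Lie_center T"
    then obtain z where z: "z \<in> H" "u = e z" by (auto simp: Lie_center_def transport_simps)
    have "x \<otimes>\<^bsub>G\<^esub> z \<oplus>\<^bsub>G\<^esub> z \<otimes>\<^bsub>G\<^esub> x = \<zero>\<^bsub>G\<^esub>" if "x \<in> H" for x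
    proof -
      have "e x \<otimes>\<^bsub>T\<^esub> e z \<oplus>\<^bsub>T\<^esub> e z \<otimes>\<^bsub>T\<^esub> e x = \<zero>\<^bsub>T\<^esub>"
        using u z that by (auto simp: Lie_center_def transport_simps(1))
      then show ?thesis
        using z that by (simp add: transport_simps bracket_mem add_mem eq0)
    qed
    then show "u \<in> e ` (Lie_center G \<inter> H)" using Z_H z by blast
  next
    fix u assume "u \<in> e ` (Lie_center G \<inter> H)"
    then obtain z where z: "z \<in> H" "z \<in> Lie_center G" "u = e z" by blast
    have "e x \<otimes>\<^bsub>T\<^esub> e z \<oplus>\<^bsub>T\<^esub> e z \<otimes>\<^bsub>T\<^esub> e x = \<zero>\<^bsub>T\<^esub>" if "x \<in> H" for x
      using Z_zero[OF z(2) mem_carrier[OF that]] z(1) that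
      by (simp add: transport_simps bracket_mem)
    then show "u \<in> Lie_center T"
      using z by (simp add: Lie_center_def transport_simps(1))
  qed
  have f'_e: "f' (e x) = f x" if "x \<in> H" for x using that by (simp add: f'_def)
  have kerT: "a_kernel T Q f' = e ` (a_kernel G Q f \<inter> H)"
    using f'_e mem_carrier by (auto simp: a_kernel_def' transport_simps)
  have "f' \<in> leibniz_hom K T Q"
    using mem_carrier
    by (auto simp: leibniz_hom_def transport_simps f'_e f_add f_smult f_bracket f_closed
        add_mem smult_mem bracket_mem)
  moreover have "f' ` carrier T = carrier Q"
    using onto f'_e by (force simp: transport_simps image_image)
  moreover have "a_kernel T Q f' \<subseteq> Lie_center T"
    using ker by (auto simp: kerT ZT)
  ultimately show "Lie_central_extension K T f' Q"
    using transport_leibniz_algebra Q by (simp add: Lie_central_extension_def)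
  show "a_kernel G Q f = Lie_center G \<Longrightarrow> a_kernel T Q f' = Lie_center T"
    by (simp add: kerT ZT)
  have "f z \<in> f ` (Lie_center G \<inter> H)" if z: "z \<in> Lie_center G" for z
  proof -
    obtain h k where hk: "h \<in> H" "k \<in> Lie_center G" "z = h \<oplus>\<^bsub>G\<^esub> k" "f h = f z"
      using split[OF Z_carrier[OF z]] by blast
    have c: "h \<in> carrier G" "k \<in> carrier G" using hk mem_carrier Z_carrier by auto
    have "x \<otimes>\<^bsub>G\<^esub> h \<oplus>\<^bsub>G\<^esub> h \<otimes>\<^bsub>G\<^esub> x = \<zero>\<^bsub>G\<^esub>" if x: "x \<in> carrier G" for x
    proof -
      have "x \<otimes>\<^bsub>G\<^esub> h \<oplus>\<^bsub>G\<^esub> h \<otimes>\<^bsub>G\<^esub> x =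
          (x \<otimes>\<^bsub>G\<^esub> h \<oplus>\<^bsub>G\<^esub> h \<otimes>\<^bsub>G\<^esub> x) \<oplus>\<^bsub>G\<^esub> (x \<otimes>\<^bsub>G\<^esub> k \<oplus>\<^bsub>G\<^esub> k \<otimes>\<^bsub>G\<^esub> x)"
        using Z_zero[OF hk(2) x] c x by (simp add: bracket_closed)
      also have "\<dots> = x \<otimes>\<^bsub>G\<^esub> z \<oplus>\<^bsub>G\<^esub> z \<otimes>\<^bsub>G\<^esub> x"
        using c x unfolding hk(3)
        by (simp add: bracket_add_left bracket_add_right bracket_closed M.a_ac)
      finally show ?thesis using Z_zero[OF z x] by simp
    qed
    then have "h \<in> Lie_center G" using c by (simp add: Lie_center_def)
    then show ?thesis using hk by (metis IntI imageI)
  qed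
  then have "f ` (Lie_center G \<inter> H) = f ` Lie_center G" by blast
  moreover have "f' ` Lie_center T = f ` (Lie_center G \<inter> H)"
    unfolding ZT image_image by (rule image_cong) (auto simp: f'_e)
  ultimately show "f' ` Lie_center T = f ` Lie_center G" by simp
qed

end

end

lemma Lie_central_extension_reduce:
  includes cardinal_syntax
  fixes G :: "('k, 'g, 'n) module_scheme" and Q :: "('k, 'a, 'p) module_scheme"
  assumes ext: "Lie_central_extension K G f Q"
  obtains G' :: "('k, 'a list) module" and f'
  where "Lie_central_extension K G' f' Q" "f' ` Lie_center G' = f ` Lie_center G"
    "a_kernel G Q f = Lie_center G \<Longrightarrow> a_kernel G' Q f' = Lie_center G'"
proof -
  have G: "leibniz_algebra K G" and Q: "leibniz_algebra K Q" and onto: "f ` carrier G = carrier Q"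
    and hom: "f \<in> leibniz_hom K G Q"
    using ext by (auto simp: Lie_central_extension_def)
  interpret G: leibniz_algebra K G by (rule G)
  interpret Q: leibniz_algebra K Q by (rule Q)
  have "f \<zero>\<^bsub>G\<^esub> \<oplus>\<^bsub>Q\<^esub> f \<zero>\<^bsub>G\<^esub> = f \<zero>\<^bsub>G\<^esub>" and f0: "f \<zero>\<^bsub>G\<^esub> \<in> carrier Q"
    using hom by (auto simp: leibniz_hom_def) (metis G.M.l_zero G.M.zero_closed)
  then have f0: "f \<zero>\<^bsub>G\<^esub> = \<zero>\<^bsub>Q\<^esub>"
    by simp
  define s where "s q = (if q = \<zero>\<^bsub>Q\<^esub> then \<zero>\<^bsub>G\<^esub> else inv_into (carrier G) f q)" for q
  have s: "s q \<in> carrier G" "f (s q) = q" if "q \<in> carrier Q" for q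
    using that onto f0 by (auto simp: s_def inv_into_into f_inv_into_f)
  define step where "step X = X \<union> (\<lambda>(x, y). x \<oplus>\<^bsub>G\<^esub> y) ` (X \<times> X)
    \<union> (\<lambda>(x, y). x \<otimes>\<^bsub>G\<^esub> y) ` (X \<times> X) \<union> (\<lambda>(a, x). a \<odot>\<^bsub>G\<^esub> x) ` (carrier K \<times> X)" for X
  define S where "S n = (step ^^ n) (s ` carrier Q)" for n
  define H where "H = (\<Union>n. S n)"
  have S0: "S 0 = s ` carrier Q" and SSuc: "S (Suc n) = step (S n)" for n
    by (simp_all add: S_def)
  have mono: "S m \<subseteq> S n" if "m \<le> n" for m n
    using that by (rule lift_Suc_mono_le[rotated]) (auto simp: SSuc step_def)
  then have joint: "\<exists>n. x \<in> S n \<and> y \<in> S n" if "x \<in> H" "y \<in> H" for x y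
    using that unfolding H_def by (metis UN_E nat_le_linear mono subsetD)
  have S_carrier: "S n \<subseteq> carrier G" for n
    by (induction n) (auto simp: S0 s SSuc step_def G.bracket_closed subset_iff)
  have memI: "x \<in> step (S n) \<Longrightarrow> x \<in> H" for x n
    unfolding H_def using SSuc by blast
  interpret H: leibniz_subalgebra K G H
  proof
    show "H \<subseteq> carrier G" using S_carrier by (auto simp: H_def)
    have "\<zero>\<^bsub>G\<^esub> = s \<zero>\<^bsub>Q\<^esub>" by (simp add: s_def)
    then show "\<zero>\<^bsub>G\<^esub> \<in> H" unfolding H_def using S0 by blast
    show "x \<oplus>\<^bsub>G\<^esub> y \<in> H" "x \<otimes>\<^bsub>G\<^esub> y \<in> H" if xy: "x \<in> H" "y \<in> H" for x y
    proof -
      obtain n where "x \<in> S n" "y \<in> S n" using joint[OF xy] by blast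
      then show "x \<oplus>\<^bsub>G\<^esub> y \<in> H" "x \<otimes>\<^bsub>G\<^esub> y \<in> H"
        by (auto intro!: memI[of _ n] simp: step_def)
    qed
    show "a \<odot>\<^bsub>G\<^esub> x \<in> H" if a: "a \<in> carrier K" and x: "x \<in> H" for a x
    proof -
      obtain n where "x \<in> S n" using joint[OF x x] by blast
      then show ?thesis using a by (auto intro!: memI[of _ n] simp: step_def)
    qed
  qed
  let ?U = "UNIV :: 'a list set"
  have inf: "infinite ?U" by (rule infinite_UNIV_listI)
  have "|H| \<le>o |?U|"
  proof (cases "carrier Q = {\<zero>\<^bsub>Q\<^esub>}")
    case True
    have "S n = {\<zero>\<^bsub>G\<^esub>}" for n
    proof (induction n)
      case 0
      then show ?case by (simp add: S0 True s_def)
    next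
      case (Suc n)
      have "\<zero>\<^bsub>G\<^esub> \<otimes>\<^bsub>G\<^esub> \<zero>\<^bsub>G\<^esub> = \<zero>\<^bsub>G\<^esub>"
        using G.bracket_add_left[of "\<zero>\<^bsub>G\<^esub>" "\<zero>\<^bsub>G\<^esub>" "\<zero>\<^bsub>G\<^esub>"] G.bracket_closed[of "\<zero>\<^bsub>G\<^esub>" "\<zero>\<^bsub>G\<^esub>"]
        by (simp add: G.M.add.r_cancel_one)
      then show ?case by (auto simp: SSuc step_def Suc)
    qed
    then have "H = {\<zero>\<^bsub>G\<^esub>}" by (simp add: H_def)
    then show ?thesis
      by (simp add: card_of_singl_ordLeq)
  next
    case False
    then obtain q where q: "q \<in> carrier Q" "q \<noteq> \<zero>\<^bsub>Q\<^esub>" by blast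
    have "inj_on (\<lambda>a. a \<odot>\<^bsub>Q\<^esub> q) (carrier K)"
    proof (rule inj_onI, rule ccontr)
      fix a b assume ab: "a \<in> carrier K" "b \<in> carrier K" "a \<odot>\<^bsub>Q\<^esub> q = b \<odot>\<^bsub>Q\<^esub> q" "a \<noteq> b"
      define c where "c = a \<ominus>\<^bsub>K\<^esub> b"
      have "c \<oplus>\<^bsub>K\<^esub> b = a"
        using ab by (simp add: c_def a_minus_def G.K.a_assoc G.K.l_neg)
      then have c: "c \<in> carrier K" "c \<noteq> \<zero>\<^bsub>K\<^esub>" using ab by (auto simp: c_def)
      have "c \<odot>\<^bsub>Q\<^esub> q = \<zero>\<^bsub>Q\<^esub>"
        using ab q by (simp add: c_def a_minus_def Q.smult_l_distr Q.smult_l_minus Q.M.r_neg)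
      moreover have "c \<in> Units K" using c by (simp add: G.K.field_Units)
      ultimately have "(inv\<^bsub>K\<^esub> c \<otimes>\<^bsub>K\<^esub> c) \<odot>\<^bsub>Q\<^esub> q = \<zero>\<^bsub>Q\<^esub>"
        using c q by (subst Q.smult_assoc1) auto
      then show False using \<open>c \<in> Units K\<close> q by simp
    qed
    then have K_le_a: "|carrier K| \<le>o |UNIV :: 'a set|" by (rule card_of_ordLeqI) simp
    have "inj (\<lambda>x :: 'a. [x])" by (simp add: inj_def)
    then have a_le: "|UNIV :: 'a set| \<le>o |?U|" by (rule card_of_ordLeqI) simp
    have K_le: "|carrier K| \<le>o |?U|" using K_le_a a_le by (rule ordLeq_transitive)
    have Q_le: "|carrier Q| \<le>o |?U|" using card_of_mono1[OF subset_UNIV] a_le by (rule ordLeq_transitive)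
    have co: "Card_order |?U|" by (rule card_of_Card_order)
    have prod: "|A \<times> B| \<le>o |?U|" if "|A| \<le>o |?U|" "|B| \<le>o |?U|" for A :: "'x set" and B :: "'y set"
      by (rule card_of_Times_ordLeq_infinite_Field)
        (use that inf co in \<open>auto simp only: Field_card_of\<close>)
    have im: "|h ` A| \<le>o |?U|" if "|A| \<le>o |?U|" for A :: "'x set" and h :: "'x \<Rightarrow> 'y"
      using card_of_image that by (rule ordLeq_transitive)
    have un: "|A \<union> B| \<le>o |?U|" if "|A| \<le>o |?U|" "|B| \<le>o |?U|" for A B :: "'x set"
      by (rule card_of_Un_ordLeq_infinite_Field)
        (use that inf co in \<open>auto simp only: Field_card_of\<close>)
    have "|S n| \<le>o |?U|" for n
    proof (induction n)
      case 0
      then show ?case by (simp add: S0 im Q_le)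
    next
      case (Suc n)
      then show ?case unfolding SSuc step_def by (intro un im prod K_le)
    qed
    moreover have "|UNIV :: nat set| \<le>o |?U|" using inf infinite_iff_card_of_nat by blast
    ultimately show ?thesis
      unfolding H_def using card_of_UNION_ordLeq_infinite[OF inf] by blast
  qed
  then have "\<exists>e :: 'g \<Rightarrow> 'a list. inj_on e H \<and> e ` H \<subseteq> ?U"
    by (simp only: card_of_ordLeq)
  then obtain e :: "'g \<Rightarrow> 'a list" where e: "inj_on e H"
    by blast
  have "f ` H = carrier Q"
  proof
    show "f ` H \<subseteq> carrier Q" using H.subset onto by blast
    show "carrier Q \<subseteq> f ` H"
    proof
      fix q assume q: "q \<in> carrier Q"
      then have "s q \<in> H" unfolding H_def using S0 by blast
      then show "q \<in> f ` H" using s(2)[OF q] by (metis imageI)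
    qed
  qed
  from H.transport_extension[OF e ext this] show thesis by (rule that)
qed

theorem precise_Lie_center_subset:
  fixes G :: "('k, 'g, 'n) module_scheme" and Q :: "('k, 'a, 'p) module_scheme"
  assumes "Lie_central_extension K G f Q"
  shows "precise_Lie_center K Q \<subseteq> f ` Lie_center G"
proof -
  obtain G' :: "('k, 'a list) module" and f' where "Lie_central_extension K G' f' Q"
    "f' ` Lie_center G' = f ` Lie_center G"
    by (rule Lie_central_extension_reduce[OF assms]) blast
  then show ?thesis unfolding precise_Lie_center_def by blast
qed

theorem Lie_capableI:
  fixes G :: "('k, 'g, 'n) module_scheme" and Q :: "('k, 'a, 'p) module_scheme"
  assumes "Lie_central_extension K G f Q" and "a_kernel G Q f = Lie_center G"
  shows "Lie_capable K Q"
proof -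
  obtain G' :: "('k, 'a list) module" and f' where "Lie_central_extension K G' f' Q"
    "a_kernel G' Q f' = Lie_center G'"
    by (rule Lie_central_extension_reduce[OF assms(1)]) (use assms(2) in simp)
  then show ?thesis unfolding Lie_capable_def by blast
qed

end

theory Submission
  imports Defs
begin

text \<open>
  If \<open>f\<close> is a Lie-central extension of \<open>Q\<close> whose kernel is the whole Lie-center, then \<open>f\<close>
  sends the Lie-center to \<open>0\<close>, so the precise Lie-center, being an intersection of sets that all
  contain \<open>0\<close>, is \<open>{0}\<close>.

  For the converse, form the fibre product \<open>P\<close> over \<open>Q\<close> of a family of Lie-central extensions
  \<open>f\<^sub>i : G\<^sub>i \<rightarrow> Q\<close>. All operations of \<open>P\<close> are componentwise, so an
  element of \<open>P\<close> over \<open>0\<close> is Lie-central because its components are, and the projection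
  \<open>P \<rightarrow> Q\<close> is again a Lie-central extension (\<open>fibre_product_extension\<close>). Moreover \<open>P\<close> projects
  onto every \<open>G\<^sub>i\<close>, so the components of a Lie-central element of \<open>P\<close> are Lie-central
  (\<open>component_Lie_center\<close>), and \<open>P \<rightarrow> Q\<close> sends the Lie-center of \<open>P\<close> into
  \<open>f\<^sub>i(Z(G\<^sub>i))\<close> for every \<open>i\<close> (\<open>fst_Lie_center\<close>). For the family of all extensions that
  define the precise Lie-center of \<open>Q\<close>, the Lie-center of \<open>P\<close> therefore lands in the precise
  Lie-center. If that is \<open>0\<close>, the Lie-center of \<open>P\<close> is contained in the kernel of \<open>P \<rightarrow> Q\<close>,
  hence equal to it, and \<open>Q\<close> is Lie-capable. The elements of \<open>P\<close> are functions on the family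
  of extensions and so form a larger type than the one over which Lie-capability quantifies;
  \<open>Lie_capableI\<close> bridges this.
\<close>

section \<open>Zero and negation in Leibniz algebras\<close>

text \<open>
  Reading negation as a scalar multiple makes additive inverses and differences in the fibre
  product componentwise as soon as addition and scalar multiplication are.
\<close>

lemma (in module) smult_minus_one:
  assumes "x \<in> carrier M"
  shows "(\<ominus> \<one>) \<odot>\<^bsub>M\<^esub> x = \<ominus>\<^bsub>M\<^esub> x"
  using assms by (simp add: smult_l_minus)

lemma (in leibniz_algebra) bracket_zero:
  assumes "x \<in> carrier L"
  shows "x \<otimes>\<^bsub>L\<^esub> \<zero>\<^bsub>L\<^esub> = \<zero>\<^bsub>L\<^esub>" and "\<zero>\<^bsub>L\<^esub> \<otimes>\<^bsub>L\<^esub> x = \<zero>\<^bsub>L\<^esub>"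
proof -
  show "x \<otimes>\<^bsub>L\<^esub> \<zero>\<^bsub>L\<^esub> = \<zero>\<^bsub>L\<^esub>"
    using bracket_smult_right[of "\<zero>\<^bsub>K\<^esub>" x "\<zero>\<^bsub>L\<^esub>"] assms by (simp add: bracket_closed)
  show "\<zero>\<^bsub>L\<^esub> \<otimes>\<^bsub>L\<^esub> x = \<zero>\<^bsub>L\<^esub>"
    using bracket_smult_left[of "\<zero>\<^bsub>K\<^esub>" "\<zero>\<^bsub>L\<^esub>" x] assms by (simp add: bracket_closed)
qed

lemma (in leibniz_algebra) zero_in_Lie_center: "\<zero>\<^bsub>L\<^esub> \<in> Lie_center L"
  by (simp add: Lie_center_def bracket_zero)

lemma leibniz_hom_zero:
  assumes "leibniz_algebra K G" "leibniz_algebra K H" "f \<in> leibniz_hom K G H"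
  shows "f \<zero>\<^bsub>G\<^esub> = \<zero>\<^bsub>H\<^esub>"
proof -
  interpret G: leibniz_algebra K G by fact
  interpret H: leibniz_algebra K H by fact
  have "f (\<zero>\<^bsub>K\<^esub> \<odot>\<^bsub>G\<^esub> \<zero>\<^bsub>G\<^esub>) = \<zero>\<^bsub>K\<^esub> \<odot>\<^bsub>H\<^esub> f \<zero>\<^bsub>G\<^esub>" and "f \<zero>\<^bsub>G\<^esub> \<in> carrier H"
    using assms(3) by (auto simp: leibniz_hom_def simp del: G.smult_r_null G.smult_l_null)
  then show ?thesis by simp
qed

section \<open>Fibre products of Lie-central extensions\<close>

text \<open>
  The common image in \<open>Q\<close> is stored as a first component. This makes the projection to \<open>Q\<close>
  available without singling out an index, and gives the fibre product of the empty family its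
  correct value \<open>Q\<close>.
\<close>

definition fibre_product ::
  "'i set \<Rightarrow> ('i \<Rightarrow> ('k, 'g, 'p) module_scheme) \<Rightarrow> ('i \<Rightarrow> 'g \<Rightarrow> 'a) \<Rightarrow> ('k, 'a, 'n) module_scheme
    \<Rightarrow> ('k, 'a \<times> ('i \<Rightarrow> 'g)) module" where
  "fibre_product I G f Q =
    \<lparr>carrier = {x. fst x \<in> carrier Q \<and> snd x \<in> (\<Pi>\<^sub>E i\<in>I. carrier (G i)) \<and>
        (\<forall>i\<in>I. f i (snd x i) = fst x)},
     mult = (\<lambda>x y. (fst x \<otimes>\<^bsub>Q\<^esub> fst y, \<lambda>i\<in>I. snd x i \<otimes>\<^bsub>G i\<^esub> snd y i)),
     one = (\<one>\<^bsub>Q\<^esub>, \<lambda>i\<in>I. \<one>\<^bsub>G i\<^esub>),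
     zero = (\<zero>\<^bsub>Q\<^esub>, \<lambda>i\<in>I. \<zero>\<^bsub>G i\<^esub>),
     add = (\<lambda>x y. (fst x \<oplus>\<^bsub>Q\<^esub> fst y, \<lambda>i\<in>I. snd x i \<oplus>\<^bsub>G i\<^esub> snd y i)),
     smult = (\<lambda>a x. (a \<odot>\<^bsub>Q\<^esub> fst x, \<lambda>i\<in>I. a \<odot>\<^bsub>G i\<^esub> snd x i))\<rparr>"

locale Lie_central_family = leibniz_algebra K Q for K (structure) and Q (structure) +
  fixes I :: "'i set" and G :: "'i \<Rightarrow> ('k, 'g, 'p) module_scheme" and f :: "'i \<Rightarrow> 'g \<Rightarrow> 'b"
  assumes extension: "i \<in> I \<Longrightarrow> Lie_central_extension K (G i) (f i) Q"
begin

abbreviation "P \<equiv> fibre_product I G f Q"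

lemma leibniz_component: "i \<in> I \<Longrightarrow> leibniz_algebra K (G i)"
  using extension by (simp add: Lie_central_extension_def)

lemma module_component: "i \<in> I \<Longrightarrow> module K (G i)"
  using leibniz_component by (simp add: leibniz_algebra_def)

lemma group_component: "i \<in> I \<Longrightarrow> abelian_group (G i)"
  using module_component by (simp add: module_def)

lemma monoid_component: "i \<in> I \<Longrightarrow> abelian_monoid (G i)"
  using group_component by (simp add: abelian_group_def)

lemmas component_simps =
  abelian_monoid.a_closed[OF monoid_component] abelian_monoid.zero_closed[OF monoid_component]
  abelian_monoid.a_assoc[OF monoid_component] abelian_monoid.a_comm[OF monoid_component]
  abelian_monoid.a_lcomm[OF monoid_component]
  abelian_monoid.l_zero[OF monoid_component] abelian_monoid.r_zero[OF monoid_component]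
  abelian_group.l_neg[OF group_component]
  module.smult_closed[OF module_component] module.smult_l_distr[OF module_component]
  module.smult_r_distr[OF module_component] module.smult_assoc1[OF module_component]
  module.smult_one[OF module_component]
  module.smult_minus_one[OF module_component]
  leibniz_algebra.bracket_closed[OF leibniz_component]
  leibniz_algebra.bracket_add_left[OF leibniz_component]
  leibniz_algebra.bracket_add_right[OF leibniz_component]
  leibniz_algebra.bracket_smult_left[OF leibniz_component]
  leibniz_algebra.bracket_smult_right[OF leibniz_component]

lemma hom_component: "i \<in> I \<Longrightarrow> f i \<in> leibniz_hom K (G i) Q"
  using extension by (simp add: Lie_central_extension_def)

lemma hom_simps:
  assumes "i \<in> I"
  shows "f i \<zero>\<^bsub>G i\<^esub> = \<zero>\<^bsub>Q\<^esub>"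
    and "x \<in> carrier (G i) \<Longrightarrow> f i x \<in> carrier Q"
    and "\<lbrakk>x \<in> carrier (G i); y \<in> carrier (G i)\<rbrakk> \<Longrightarrow> f i (x \<oplus>\<^bsub>G i\<^esub> y) = f i x \<oplus>\<^bsub>Q\<^esub> f i y"
    and "\<lbrakk>x \<in> carrier (G i); y \<in> carrier (G i)\<rbrakk> \<Longrightarrow> f i (x \<otimes>\<^bsub>G i\<^esub> y) = f i x \<otimes>\<^bsub>Q\<^esub> f i y"
    and "\<lbrakk>a \<in> carrier K; x \<in> carrier (G i)\<rbrakk> \<Longrightarrow> f i (a \<odot>\<^bsub>G i\<^esub> x) = a \<odot>\<^bsub>Q\<^esub> f i x"
proof -
  show "f i \<zero>\<^bsub>G i\<^esub> = \<zero>\<^bsub>Q\<^esub>"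
    by (rule leibniz_hom_zero[OF leibniz_component _ hom_component])
      (use assms leibniz_algebra_axioms in auto)
qed (use hom_component[OF assms] in \<open>auto simp: leibniz_hom_def\<close>)

lemma fibre_product_simps:
  "fst \<zero>\<^bsub>P\<^esub> = \<zero>\<^bsub>Q\<^esub>" "i \<in> I \<Longrightarrow> snd \<zero>\<^bsub>P\<^esub> i = \<zero>\<^bsub>G i\<^esub>"
  "fst (x \<oplus>\<^bsub>P\<^esub> y) = fst x \<oplus>\<^bsub>Q\<^esub> fst y" "i \<in> I \<Longrightarrow> snd (x \<oplus>\<^bsub>P\<^esub> y) i = snd x i \<oplus>\<^bsub>G i\<^esub> snd y i"
  "fst (x \<otimes>\<^bsub>P\<^esub> y) = fst x \<otimes>\<^bsub>Q\<^esub> fst y" "i \<in> I \<Longrightarrow> snd (x \<otimes>\<^bsub>P\<^esub> y) i = snd x i \<otimes>\<^bsub>G i\<^esub> snd y i"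
  "fst (a \<odot>\<^bsub>P\<^esub> x) = a \<odot>\<^bsub>Q\<^esub> fst x" "i \<in> I \<Longrightarrow> snd (a \<odot>\<^bsub>P\<^esub> x) i = a \<odot>\<^bsub>G i\<^esub> snd x i"
  by (simp_all add: fibre_product_def)

lemma fibre_product_carrierD:
  assumes "x \<in> carrier P"
  shows "fst x \<in> carrier Q"
    and "i \<in> I \<Longrightarrow> snd x i \<in> carrier (G i)" and "i \<in> I \<Longrightarrow> f i (snd x i) = fst x"
  using assms by (auto simp: fibre_product_def)

lemma fibre_product_carrierI:
  assumes "fst x \<in> carrier Q" and "snd x \<in> extensional I"
    and "\<And>i. i \<in> I \<Longrightarrow> snd x i \<in> carrier (G i) \<and> f i (snd x i) = fst x"
  shows "x \<in> carrier P"
  using assms by (auto simp: fibre_product_def PiE_iff)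

lemma fibre_product_extensional:
  "snd \<zero>\<^bsub>P\<^esub> \<in> extensional I" "snd (x \<oplus>\<^bsub>P\<^esub> y) \<in> extensional I"
  "snd (x \<otimes>\<^bsub>P\<^esub> y) \<in> extensional I" "snd (a \<odot>\<^bsub>P\<^esub> x) \<in> extensional I"
  by (simp_all add: fibre_product_def)

lemma fibre_product_closed:
  "\<zero>\<^bsub>P\<^esub> \<in> carrier P"
  "\<lbrakk>x \<in> carrier P; y \<in> carrier P\<rbrakk> \<Longrightarrow> x \<oplus>\<^bsub>P\<^esub> y \<in> carrier P"
  "\<lbrakk>x \<in> carrier P; y \<in> carrier P\<rbrakk> \<Longrightarrow> x \<otimes>\<^bsub>P\<^esub> y \<in> carrier P"
  "\<lbrakk>a \<in> carrier K; x \<in> carrier P\<rbrakk> \<Longrightarrow> a \<odot>\<^bsub>P\<^esub> x \<in> carrier P"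
  by (rule fibre_product_carrierI;
      simp add: fibre_product_extensional fibre_product_simps fibre_product_carrierD
        component_simps hom_simps bracket_closed)+

lemma fibre_product_eqI:
  assumes "x \<in> carrier P" "y \<in> carrier P" "fst x = fst y"
    and "\<And>i. i \<in> I \<Longrightarrow> snd x i = snd y i"
  shows "x = y"
proof (rule prod_eqI)
  have "snd x \<in> (\<Pi>\<^sub>E i\<in>I. carrier (G i))" "snd y \<in> (\<Pi>\<^sub>E i\<in>I. carrier (G i))"
    using assms(1,2) by (auto simp: fibre_product_def)
  then show "snd x = snd y"
    by (rule PiE_ext) (rule assms(4))
qed (rule assms(3))

lemmas pointwise_simps = fibre_product_closed fibre_product_simps fibre_product_carrierD
  component_simps M.a_ac

lemma fibre_product_abelian_group: "abelian_group P"
proof (rule abelian_groupI)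
  fix x assume x: "x \<in> carrier P"
  show "\<exists>y\<in>carrier P. y \<oplus>\<^bsub>P\<^esub> x = \<zero>\<^bsub>P\<^esub>"
  proof
    show "(\<ominus>\<^bsub>K\<^esub> \<one>\<^bsub>K\<^esub>) \<odot>\<^bsub>P\<^esub> x \<in> carrier P"
      using x by (simp add: fibre_product_closed)
    show "(\<ominus>\<^bsub>K\<^esub> \<one>\<^bsub>K\<^esub>) \<odot>\<^bsub>P\<^esub> x \<oplus>\<^bsub>P\<^esub> x = \<zero>\<^bsub>P\<^esub>"
      by (rule fibre_product_eqI)
        (use x in \<open>simp_all add: pointwise_simps smult_minus_one M.l_neg M.r_neg\<close>)
  qed
qed (rule fibre_product_eqI | simp add: pointwise_simps)+

lemma fibre_product_module: "module K P"
  by (rule moduleI[OF K.is_cring fibre_product_abelian_group])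
    (rule fibre_product_eqI
      | simp add: pointwise_simps smult_l_distr smult_r_distr smult_assoc1)+

lemma fibre_product_minus:
  assumes "x \<in> carrier P" "y \<in> carrier P"
  shows "fst (x \<ominus>\<^bsub>P\<^esub> y) = fst x \<ominus>\<^bsub>Q\<^esub> fst y"
    and "i \<in> I \<Longrightarrow> snd (x \<ominus>\<^bsub>P\<^esub> y) i = snd x i \<ominus>\<^bsub>G i\<^esub> snd y i"
    and "x \<ominus>\<^bsub>P\<^esub> y \<in> carrier P"
proof -
  have "x \<ominus>\<^bsub>P\<^esub> y = x \<oplus>\<^bsub>P\<^esub> (\<ominus>\<^bsub>K\<^esub> \<one>\<^bsub>K\<^esub>) \<odot>\<^bsub>P\<^esub> y"
    using assms by (simp add: a_minus_def module.smult_minus_one[OF fibre_product_module])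
  then show "fst (x \<ominus>\<^bsub>P\<^esub> y) = fst x \<ominus>\<^bsub>Q\<^esub> fst y"
    and "i \<in> I \<Longrightarrow> snd (x \<ominus>\<^bsub>P\<^esub> y) i = snd x i \<ominus>\<^bsub>G i\<^esub> snd y i"
    and "x \<ominus>\<^bsub>P\<^esub> y \<in> carrier P"
    using assms
    by (simp_all add: pointwise_simps a_minus_def smult_minus_one)
qed

lemma fibre_product_leibniz_algebra: "leibniz_algebra K P"
proof (rule leibniz_algebra.intro[OF K.field_axioms fibre_product_module], unfold_locales)
  fix x y z assume "x \<in> carrier P" "y \<in> carrier P" "z \<in> carrier P"
  then show "x \<otimes>\<^bsub>P\<^esub> (y \<otimes>\<^bsub>P\<^esub> z) = ((x \<otimes>\<^bsub>P\<^esub> y) \<otimes>\<^bsub>P\<^esub> z) \<ominus>\<^bsub>P\<^esub> ((x \<otimes>\<^bsub>P\<^esub> z) \<otimes>\<^bsub>P\<^esub> y)"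
    by (intro fibre_product_eqI)
      (simp_all add: pointwise_simps bracket_closed fibre_product_minus leibniz_identity leibniz_algebra.leibniz_identity[OF leibniz_component])
qed (rule fibre_product_eqI
    | simp add: pointwise_simps bracket_closed bracket_add_left bracket_add_right
        bracket_smult_left bracket_smult_right)+

lemma fibre_product_lift:
  assumes q: "q \<in> carrier Q"
  shows "\<exists>x\<in>carrier P. fst x = q"
proof
  define g where "g = (\<lambda>i\<in>I. inv_into (carrier (G i)) (f i) q)"
  have "q \<in> f i ` carrier (G i)" if "i \<in> I" for i
    using extension[OF that] q by (simp add: Lie_central_extension_def)
  then show "(q, g) \<in> carrier P"
    using q by (auto simp: fibre_product_def g_def inv_into_into f_inv_into_f)
qed simp

lemma component_surj:
  assumes i: "i \<in> I" and u: "u \<in> carrier (G i)"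
  shows "\<exists>x\<in>carrier P. snd x i = u"
proof -
  obtain x where x: "x \<in> carrier P" "fst x = f i u"
    using fibre_product_lift hom_simps(2)[OF i u] by blast
  \<comment> \<open>Replacing one component of a lift of \<open>f\<^sub>i(u)\<close> by \<open>u\<close> itself keeps it in the fibre product.\<close>
  have "(fst x, (snd x)(i := u)) \<in> carrier P"
    using x i u by (auto simp: fibre_product_def)
  then show ?thesis by force
qed

section \<open>The Lie-center of a fibre product\<close>

text \<open>
  Being Lie-central in \<open>G\<^sub>i\<close> is tested against all of \<open>G\<^sub>i\<close>, and by \<open>component_surj\<close> every
  test element is a component of an element of the fibre product.
\<close>

lemma component_Lie_center:
  assumes z: "z \<in> Lie_center P" and i: "i \<in> I"
  shows "snd z i \<in> Lie_center (G i)"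
proof -
  have zP: "z \<in> carrier P" using z by (simp add: Lie_center_def)
  have "u \<otimes>\<^bsub>G i\<^esub> snd z i \<oplus>\<^bsub>G i\<^esub> snd z i \<otimes>\<^bsub>G i\<^esub> u = \<zero>\<^bsub>G i\<^esub>" if u: "u \<in> carrier (G i)" for u
  proof -
    obtain x where x: "x \<in> carrier P" "snd x i = u"
      using component_surj[OF i u] by blast
    then have "x \<otimes>\<^bsub>P\<^esub> z \<oplus>\<^bsub>P\<^esub> z \<otimes>\<^bsub>P\<^esub> x = \<zero>\<^bsub>P\<^esub>"
      using z by (simp add: Lie_center_def)
    then have "snd (x \<otimes>\<^bsub>P\<^esub> z \<oplus>\<^bsub>P\<^esub> z \<otimes>\<^bsub>P\<^esub> x) i = snd \<zero>\<^bsub>P\<^esub> i"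
      by simp
    then show ?thesis using i x by (simp add: fibre_product_simps)
  qed
  then show ?thesis
    using fibre_product_carrierD(2)[OF zP i] by (simp add: Lie_center_def)
qed

lemma fst_Lie_center:
  assumes z: "z \<in> Lie_center P" and i: "i \<in> I"
  shows "fst z \<in> f i ` Lie_center (G i)"
proof -
  have "fst z = f i (snd z i)"
    using z i by (simp add: Lie_center_def fibre_product_carrierD)
  then show ?thesis using component_Lie_center[OF z i] by blast
qed

text \<open>
  An element over \<open>0\<close> has all its components in the kernels of the \<open>f\<^sub>i\<close>, which are Lie-central;
  since brackets are componentwise, it is Lie-central itself.
\<close>

lemma kernel_fst_subset: "a_kernel P Q fst \<subseteq> Lie_center P"
proof
  fix z assume "z \<in> a_kernel P Q fst"
  then have z: "z \<in> carrier P" "fst z = \<zero>\<^bsub>Q\<^esub>" by (auto simp: a_kernel_def')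
  have c: "snd z i \<in> Lie_center (G i)" if i: "i \<in> I" for i
  proof -
    have "snd z i \<in> a_kernel (G i) Q (f i)"
      using z i by (simp add: a_kernel_def' fibre_product_carrierD)
    then show ?thesis
      using extension[OF i] by (auto simp: Lie_central_extension_def)
  qed
  have "x \<otimes>\<^bsub>P\<^esub> z \<oplus>\<^bsub>P\<^esub> z \<otimes>\<^bsub>P\<^esub> x = \<zero>\<^bsub>P\<^esub>" if x: "x \<in> carrier P" for x
  proof (rule fibre_product_eqI)
    show "fst (x \<otimes>\<^bsub>P\<^esub> z \<oplus>\<^bsub>P\<^esub> z \<otimes>\<^bsub>P\<^esub> x) = fst \<zero>\<^bsub>P\<^esub>"
      using x z by (simp add: fibre_product_simps fibre_product_carrierD bracket_zero)
    show "snd (x \<otimes>\<^bsub>P\<^esub> z \<oplus>\<^bsub>P\<^esub> z \<otimes>\<^bsub>P\<^esub> x) i = snd \<zero>\<^bsub>P\<^esub> i" if i: "i \<in> I" for i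
      using c[OF i] i fibre_product_carrierD(2)[OF x i]
      by (simp add: fibre_product_simps Lie_center_def)
  qed (use x z in \<open>simp_all add: fibre_product_closed\<close>)
  then show "z \<in> Lie_center P" using z by (simp add: Lie_center_def)
qed

lemma fibre_product_extension: "Lie_central_extension K P fst Q"
proof -
  have "fst \<in> leibniz_hom K P Q"
    by (auto simp: leibniz_hom_def fibre_product_simps fibre_product_carrierD)
  moreover have "fst ` carrier P = carrier Q"
    using fibre_product_lift fibre_product_carrierD(1) by force
  ultimately show ?thesis
    using fibre_product_leibniz_algebra leibniz_algebra_axioms kernel_fst_subset
    by (simp add: Lie_central_extension_def)
qed

end

section \<open>Lie-capability and the precise Lie-center\<close>

text \<open>
  Once an extension sends its Lie-center to \<open>0\<close>, the precise Lie-center is squeezed between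
  \<open>{0}\<close> and that image.
\<close>

lemma precise_Lie_center_trivialI:
  fixes K :: "('k, 'm) ring_scheme" and Q :: "('k, 'a, 'n) module_scheme"
  assumes capable: "Lie_capable K Q"
  shows "precise_Lie_center K Q = {\<zero>\<^bsub>Q\<^esub>}"
proof
  show "{\<zero>\<^bsub>Q\<^esub>} \<subseteq> precise_Lie_center K Q"
  proof -
    have "\<zero>\<^bsub>Q\<^esub> \<in> f ` Lie_center G"
      if "Lie_central_extension K G f Q" for G :: "('k, 'a list) module" and f
    proof
      show "\<zero>\<^bsub>Q\<^esub> = f \<zero>\<^bsub>G\<^esub>"
        using that leibniz_hom_zero[of K G Q f] by (simp add: Lie_central_extension_def)
      show "\<zero>\<^bsub>G\<^esub> \<in> Lie_center G"
        using that
        by (intro leibniz_algebra.zero_in_Lie_center) (auto simp: Lie_central_extension_def)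
    qed
    then show ?thesis by (auto simp: precise_Lie_center_def)
  qed
  obtain G :: "('k, 'a list) module" and f
    where ext: "Lie_central_extension K G f Q" and ker: "a_kernel G Q f = Lie_center G"
    using capable by (auto simp: Lie_capable_def)
  have "f ` Lie_center G \<subseteq> {\<zero>\<^bsub>Q\<^esub>}"
    by (auto simp: ker[symmetric] a_kernel_def')
  with precise_Lie_center_subset[OF ext] show "precise_Lie_center K Q \<subseteq> {\<zero>\<^bsub>Q\<^esub>}" by blast
qed

theorem corollary4p6:
  fixes K :: "('k, 'm) ring_scheme" and Q :: "('k, 'a, 'n) module_scheme"
  assumes "field K"
    and "\<one>\<^bsub>K\<^esub> \<oplus>\<^bsub>K\<^esub> \<one>\<^bsub>K\<^esub> \<in> Units K"
    and "leibniz_algebra K Q"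
  shows "precise_Lie_center K Q = {\<zero>\<^bsub>Q\<^esub>} \<longleftrightarrow> Lie_capable K Q"
proof
  assume trivial: "precise_Lie_center K Q = {\<zero>\<^bsub>Q\<^esub>}"
  \<comment> \<open>The pairs \<open>(G, f)\<close> serve as their own indices.\<close>
  define I :: "(('k, 'a list) module \<times> ('a list \<Rightarrow> 'a)) set"
    where "I = {(G, f). Lie_central_extension K G f Q}"
  interpret Lie_central_family K Q I fst snd
    by (intro Lie_central_family.intro Lie_central_family_axioms.intro assms(3))
      (auto simp: I_def)
  have "Lie_center P \<subseteq> a_kernel P Q fst"
  proof
    fix z assume z: "z \<in> Lie_center P"
    have "fst z \<in> f ` Lie_center G"
      if "Lie_central_extension K G f Q" for G :: "('k, 'a list) module" and f
      using fst_Lie_center[OF z, of "(G, f)"] that by (simp add: I_def)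
    then have "fst z \<in> precise_Lie_center K Q"
      by (auto simp: precise_Lie_center_def)
    then show "z \<in> a_kernel P Q fst"
      using z trivial by (simp add: a_kernel_def' Lie_center_def)
  qed
  with kernel_fst_subset have "a_kernel P Q fst = Lie_center P"
    by blast
  with fibre_product_extension show "Lie_capable K Q"
    by (rule Lie_capableI)
qed (rule precise_Lie_center_trivialI)

end
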